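(* For every $0<p<1$, the parabolic maximal operator $M_{\mathrm{par}}$ is not bounded from $H^p_{\mathrm{par}}(\mathbb{R}^2)$ to $L^{p,\infty}(\mathbb{R}^2)$; that is, there is no finite constant $C$ such that $\|M_{\mathrm{par}}f\|_{L^{p,\infty}(\mathbb{R}^2)}\le C\|f\|_{H^p_{\mathrm{par}}(\mathbb{R}^2)}$ for all $f\in H^p_{\mathrm{par}}(\mathbb{R}^2)$.
   Context: Fix a nonnegative smooth bump function $\varphi$ on $\mathbb{R}$ with $\varphi\le 1$, $\varphi\equiv 1$ on $(1,2)$ and $\operatorname{supp}\varphi\subseteq(1/2,5/2)$. For $f\in L^1_{\mathrm{loc}}(\mathbb{R}^2)$ and $r>0$ let $$A_rf(x)=\int_{\mathbb{R}}f(x_1-t,x_2-t^2)\,\varphi(t/r)\,\frac{dt}{r},\qquad M_{\mathrm{par}}f(x)=\sup_{r>0}|A_rf(x)|,$$ which is understood for almost every $x=(x_1,x_2)\in\mathbb{R}^2$. A parabolic box is a set $Q=Q(z,\rho)=z+[-\rho,\rho]\times[-\rho^2,\rho^2]$ with $z\in\mathbb{R}^2$, $\rho>0$; its side length is $\rho_Q=\rho(Q)=\rho$. For $0<p\le1$ fix a positive integer $N_p\ge\lfloor 3(1/p-1)\rfloor$. A parabolic $(p,\infty)$-atom (supported in, or associated with, $Q$) is a bounded measurable function $a$ on $\mathbb{R}^2$ for which there is a parabolic box $Q$ with $\operatorname{supp}a\subset Q$, $\|a\|_{L^\infty(\mathbb{R}^2)}\le|Q|^{-1/p}$, and $\int_{\mathbb{R}^2}x^\beta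 a(x)\,dx=0$ for all $\beta=(\beta_1,\beta_2)\in\mathbb{N}^2$ (with $0\in\mathbb{N}$) with $|\beta|=\beta_1+\beta_2\le N_p$, where $x^\beta=x_1^{\beta_1}x_2^{\beta_2}$. $H^p_{\mathrm{par}}(\mathbb{R}^2)$ is the space of all tempered distributions $f\in L^1_{\mathrm{loc}}(\mathbb{R}^2)$ admitting a (countable) representation $f=\sum_Q\lambda_Qa_Q$, converging in $L^1_{\mathrm{loc}}(\mathbb{R}^2)$, with each $a_Q$ a parabolic $(p,\infty)$-atom and $\sum_Q|\lambda_Q|^p<\infty$ (the boxes $Q$ are not required to be disjoint); $\|f\|_{H^p_{\mathrm{par}}}^p$ is the infimum of $\sum_Q|\lambda_Q|^p$ over all such representations. For measurable $f$, $\|f\|_{L^{p,\infty}(\mathbb{R}^2)}=\sup_{\alpha>0}\alpha\,|\{x\in\mathbb{R}^2:|f(x)|>\alpha\}|^{1/p}$, and $L^{p,\infty}(\mathbb{R}^2)$ is the space of measurable $f$ for which this is finite. *)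

theory Defs
  imports "HOL-Analysis.Analysis"
begin

subsection \<open>Smooth functions and tempered distributions\<close>

fun partials :: "'a::euclidean_space list \<Rightarrow> ('a \<Rightarrow> 'b::real_normed_vector) \<Rightarrow> 'a \<Rightarrow> 'b" where
  "partials [] f = f"
| "partials (v # vs) f = (\<lambda>x. frechet_derivative (partials vs f) (at x) v)"

definition smooth :: "('a::euclidean_space \<Rightarrow> 'b::real_normed_vector) \<Rightarrow> bool" where
  "smooth f \<longleftrightarrow> (\<forall>vs. set vs \<subseteq> Basis \<longrightarrow> (\<forall>x. partials vs f differentiable (at x)))"

definition schwartz :: "('a::euclidean_space \<Rightarrow> complex) \<Rightarrow> bool" where
  "schwartz \<psi> \<longleftrightarrow> smooth \<psi> \<and>
     (\<forall>k vs. set vs \<subseteq> Basis \<longrightarrow> bounded (range (\<lambda>x. norm x ^ k *\<^sub>R partials vs \<psi> x)))"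

definition schwartz_norm :: "nat \<Rightarrow> ('a::euclidean_space \<Rightarrow> complex) \<Rightarrow> real" where
  "schwartz_norm m \<psi> =
     (\<Sum>k\<le>m. \<Sum>vs | set vs \<subseteq> Basis \<and> length vs \<le> m.
        SUP x. norm x ^ k * norm (partials vs \<psi> x))"

text \<open>The norms above increase with \<open>m\<close> and generate the topology of the Schwartz space, so
  continuity of a linear functional is a bound by one of them. Only the values of \<open>T\<close> on
  Schwartz functions are relevant.\<close>

definition tempered_distribution :: "(('a::euclidean_space \<Rightarrow> complex) \<Rightarrow> complex) \<Rightarrow> bool" where
  "tempered_distribution T \<longleftrightarrow>
     (\<forall>\<psi> \<eta>. schwartz \<psi> \<longrightarrow> schwartz \<eta> \<longrightarrow> T (\<lambda>x. \<psi> x + \<eta> x) = T \<psi> + T \<eta>) \<and>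
     (\<forall>c \<psi>. schwartz \<psi> \<longrightarrow> T (\<lambda>x. c * \<psi> x) = c * T \<psi>) \<and>
     (\<exists>C m. \<forall>\<psi>. schwartz \<psi> \<longrightarrow> norm (T \<psi>) \<le> C * schwartz_norm m \<psi>)"

definition L1_loc :: "('a::euclidean_space \<Rightarrow> complex) \<Rightarrow> bool" where
  "L1_loc f \<longleftrightarrow> (\<forall>K. compact K \<longrightarrow> f absolutely_integrable_on K)"

definition L1_loc_tempered :: "('a::euclidean_space \<Rightarrow> complex) \<Rightarrow> bool" where
  "L1_loc_tempered f \<longleftrightarrow> L1_loc f \<and>
     (\<exists>T. tempered_distribution T \<and>
       (\<forall>\<psi>. smooth \<psi> \<longrightarrow> compact (closure {x. \<psi> x \<noteq> 0}) \<longrightarrow>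
          T \<psi> = (LINT x|lebesgue. f x * \<psi> x)))"

subsection \<open>The parabolic maximal operator\<close>

text \<open>For \<open>f\<close> in \<open>L\<^sup>1\<^sub>l\<^sub>o\<^sub>c\<close> and almost every \<open>x\<close> the integrand is integrable for all \<open>r > 0\<close>
  simultaneously; on the exceptional null set the Bochner integral takes a default value. The
  integral uses \<open>lebesgue\<close> because \<open>f\<close> need not be Borel.\<close>

definition A_par :: "(real \<Rightarrow> real) \<Rightarrow> real \<Rightarrow> (real \<times> real \<Rightarrow> complex) \<Rightarrow> real \<times> real \<Rightarrow> complex" where
  "A_par \<phi> r f x = (LINT t|lebesgue. (\<phi> (t / r) / r) *\<^sub>R f (fst x - t, snd x - t\<^sup>2))"

definition M_par :: "(real \<Rightarrow> real) \<Rightarrow> (real \<times> real \<Rightarrow> complex) \<Rightarrow> real \<times> real \<Rightarrow> ennreal" where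
  "M_par \<phi> f x = (SUP r\<in>{0<..}. ennreal (norm (A_par \<phi> r f x)))"

subsection \<open>Parabolic Hardy spaces\<close>

definition par_box :: "real \<times> real \<Rightarrow> real \<Rightarrow> (real \<times> real) set" where
  "par_box z \<rho> = (+) z ` ({-\<rho>..\<rho>} \<times> {-(\<rho>\<^sup>2)..\<rho>\<^sup>2})"

definition par_atom :: "real \<Rightarrow> nat \<Rightarrow> (real \<times> real \<Rightarrow> complex) \<Rightarrow> bool" where
  "par_atom p N a \<longleftrightarrow>
     a \<in> borel_measurable lebesgue \<and> bounded (range a) \<and>
     (\<exists>z \<rho>. \<rho> > 0 \<and>
        closure {x. a x \<noteq> 0} \<subseteq> par_box z \<rho> \<and>
        (AE x in lebesgue. norm (a x) \<le> measure lebesgue (par_box z \<rho>) powr (- 1 / p))) \<and>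
     (\<forall>i j. i + j \<le> N \<longrightarrow> (LINT x|lebesgue. (fst x ^ i * snd x ^ j) *\<^sub>R a x) = 0)"

text \<open>Finite atomic sums are included, by padding with zero coefficients.\<close>

definition atomic_rep ::
    "real \<Rightarrow> nat \<Rightarrow> (real \<times> real \<Rightarrow> complex) \<Rightarrow> (nat \<Rightarrow> complex) \<Rightarrow> (nat \<Rightarrow> real \<times> real \<Rightarrow> complex) \<Rightarrow> bool"
  where
  "atomic_rep p N f c a \<longleftrightarrow>
     L1_loc f \<and>
     (\<forall>n. par_atom p N (a n)) \<and>
     summable (\<lambda>n. norm (c n) powr p) \<and>
     (\<forall>K. compact K \<longrightarrow>
        (\<lambda>m. LINT x:K|lebesgue. norm (f x - (\<Sum>n<m. c n * a n x))) \<longlonglongrightarrow> 0)"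

definition H_par :: "real \<Rightarrow> nat \<Rightarrow> (real \<times> real \<Rightarrow> complex) set" where
  "H_par p N = {f. L1_loc_tempered f \<and> (\<exists>c a. atomic_rep p N f c a)}"

definition H_par_norm :: "real \<Rightarrow> nat \<Rightarrow> (real \<times> real \<Rightarrow> complex) \<Rightarrow> real" where
  "H_par_norm p N f =
     (Inf {(\<Sum>n. norm (c n) powr p) | c a. atomic_rep p N f c a}) powr (1 / p)"

subsection \<open>The weak-type quasinorm\<close>

definition ennreal_powr :: "ennreal \<Rightarrow> real \<Rightarrow> ennreal" where
  \<comment> \<open>used for positive exponents only\<close>
  "ennreal_powr x s = (if x = \<infinity> then \<infinity> else ennreal (enn2real x powr s))"

text \<open>The argument plays the role of \<open>\<bar>f\<bar>\<close>; it is extended-valued because a maximal function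
  may take the value \<open>\<infinity>\<close>.\<close>

definition weak_Lp_norm :: "real \<Rightarrow> ('a::euclidean_space \<Rightarrow> ennreal) \<Rightarrow> ennreal" where
  "weak_Lp_norm p g =
     (SUP \<alpha>\<in>{0<..}. ennreal \<alpha> * ennreal_powr (emeasure lebesgue {x. g x > ennreal \<alpha>}) (1 / p))"

end

theory Submission
  imports Defs
begin

text \<open>A single atom already has a maximal function outside \<open>L\<^bsup>p,\<infinity>\<^esup>\<close>. Far out, at height \<open>x\<^sub>2 = s\<^sup>2\<close>,
  the parabola through \<open>x\<close> crosses a bounded box almost vertically, so the vanishing moments are
  invisible to the average: it sees the integral of the atom over a vertical segment, and is of
  size \<open>s\<^bsup>-2\<^esup>\<close>. The set of such \<open>x\<close> with \<open>s\<^sup>2 \<sim> T\<close> has measure of order \<open>T\<close>, and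
  \<open>T\<^bsup>-1\<^esup> T\<^bsup>1/p\<^esup>\<close> is unbounded. As atom we take an iterated difference, in the first
  variable, of a product of two tents.\<close>

section \<open>Tents and their iterated differences\<close>

definition tent :: "real \<Rightarrow> real" where
  "tent u = max 0 (1 - \<bar>u\<bar>)"

text \<open>The step 2 is the width of the support of a tent. The translates therefore meet only
  where they vanish, and the leftmost copy survives all differences unchanged.\<close>

fun tent_diff :: "nat \<Rightarrow> real \<times> real \<Rightarrow> real" where
  "tent_diff 0 x = tent (fst x) * tent (snd x)"
| "tent_diff (Suc n) x = tent_diff n x - tent_diff n (x - (2, 0))"

lemma tent_nonneg: "0 \<le> tent u"
  by (simp add: tent_def)

lemma tent_le_1: "tent u \<le> 1"
  by (simp add: tent_def)

lemma tent_eq_0: "1 \<le> \<bar>u\<bar> \<Longrightarrow> tent u = 0"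
  by (simp add: tent_def)

lemma tent_ge_half: "\<bar>u\<bar> \<le> 1 / 2 \<Longrightarrow> 1 / 2 \<le> tent u"
  by (simp add: tent_def)

lemma continuous_on_tent_diff: "continuous_on S (tent_diff n)"
proof -
  have "continuous_on UNIV (tent_diff n)"
  proof (induction n)
    case 0
    show ?case
      unfolding tent_diff.simps tent_def by (intro continuous_intros)
  next
    case (Suc n)
    have "continuous_on UNIV (\<lambda>x. tent_diff n (x - (2, 0)))"
      by (rule continuous_on_compose2[OF Suc]) (auto intro!: continuous_intros)
    with Suc show ?case
      unfolding tent_diff.simps by (intro continuous_intros)
  qed
  then show ?thesis
    using continuous_on_subset by blast
qed

lemma abs_tent_diff_le: "\<bar>tent_diff n x\<bar> \<le> 2 ^ n"
proof (induction n arbitrary: x)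
  case 0
  show ?case
    using mult_mono[OF tent_le_1[of "fst x"] tent_le_1[of "snd x"]]
    by (simp add: abs_mult tent_nonneg)
next
  case (Suc n)
  show ?case
    using Suc[of x] Suc[of "x - (2, 0)"] by simp
qed

lemma tent_diff_eq_0:
  "x \<notin> {-1..2 * real n + 1} \<times> {-1..1} \<Longrightarrow> tent_diff n x = 0"
proof (induction n arbitrary: x)
  case 0
  then have "1 \<le> \<bar>fst x\<bar> \<or> 1 \<le> \<bar>snd x\<bar>"
    by (cases x) auto
  then show ?case
    by (auto simp: tent_eq_0)
next
  case (Suc n)
  have "x \<notin> {-1..2 * real n + 1} \<times> {-1..1}" "x - (2, 0) \<notin> {-1..2 * real n + 1} \<times> {-1..1}"
    using Suc.prems by (cases x; auto)+
  then show ?case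
    using Suc.IH by simp
qed

lemma tent_diff_eq_0_snd: "1 \<le> \<bar>snd x\<bar> \<Longrightarrow> tent_diff n x = 0"
  by (induction n arbitrary: x) (auto simp: tent_eq_0)

text \<open>The subtracted term is evaluated at a first coordinate of at most -1, where the tent is
  zero. Hence the oscillating function is nonnegative on this half-plane, where the lower bound for
  the averages is obtained.\<close>

lemma tent_diff_left:
  "fst x \<le> 1 \<Longrightarrow> tent_diff n x = tent (fst x) * tent (snd x)"
proof (induction n arbitrary: x)
  case (Suc n)
  then show ?case
    by (simp add: tent_eq_0)
qed simp

section \<open>Integrals of compactly supported functions and vanishing moments\<close>

lemma integrable_lborel_compact_support:
  fixes F :: "'a::euclidean_space \<Rightarrow> 'b::euclidean_space"
  assumes "continuous_on UNIV F" "compact S" "\<And>x. x \<notin> S \<Longrightarrow> F x = 0"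
  shows "integrable lborel F"
proof -
  have "integrable lborel (\<lambda>x. indicator S x *\<^sub>R F x)"
    using assms by (intro borel_integrable_compact) (auto intro: continuous_on_subset)
  also have "(\<lambda>x. indicator S x *\<^sub>R F x) = F"
    using assms(3) by (auto simp: indicator_def)
  finally show ?thesis .
qed

lemma compact_support_tent_diff: "compact ({-1..2 * real n + 1} \<times> {-1..1::real})"
  by (intro compact_Times compact_Icc)

lemma integrable_mult_tent_diff:
  assumes "continuous_on UNIV q"
  shows "integrable lborel (\<lambda>x. q x * tent_diff n x)"
  by (rule integrable_lborel_compact_support[OF _ compact_support_tent_diff[of n]])
    (auto intro!: continuous_intros assms continuous_on_tent_diff simp: tent_diff_eq_0)

lemma integral_lborel_translate:
  fixes F :: "'a::euclidean_space \<Rightarrow> 'b::euclidean_space"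
  assumes "continuous_on UNIV F"
  shows "(LINT x|lborel. F (c + x)) = (LINT x|lborel. F x)"
proof -
  have "(LINT x|lborel. F x) = (LINT x|distr lborel borel ((+) c). F x)"
    by (simp add: lborel_distr_plus)
  also have "\<dots> = (LINT x|lborel. F (c + x))"
    using assms by (intro integral_distr) (auto intro: borel_measurable_continuous_onI)
  finally show ?thesis
    by simp
qed

text \<open>Each difference kills one more power of the first variable: after translation, the
  binomial expansion of \<open>(x + 2) ^ i\<close> has leading term \<open>x ^ i\<close>, which
  cancels, while the lower powers are covered by induction. The exponent \<open>j\<close> is
  arbitrary because the translations leave the second variable alone.\<close>

lemma tent_diff_moments:
  "i < n \<Longrightarrow> (LINT x|lborel. (fst x ^ i * snd x ^ j) * tent_diff n x) = 0"
proof (induction n arbitrary: i)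
  case (Suc n)
  let ?m = "\<lambda>i. LINT x|lborel. (fst x ^ i * snd x ^ j) * tent_diff n x"
  have cont: "continuous_on UNIV (\<lambda>x::real \<times> real. fst x ^ k * snd x ^ j)" for k
    by (intro continuous_intros)
  have shift: "continuous_on UNIV (\<lambda>x::real \<times> real. x - (2, 0))"
    by (intro continuous_intros)
  have cont': "continuous_on UNIV (\<lambda>x. (fst x ^ i * snd x ^ j) * tent_diff n (x - (2, 0)))"
    by (intro continuous_intros continuous_on_compose2[OF continuous_on_tent_diff shift]) auto
  have int: "integrable lborel (\<lambda>x. (fst x ^ i * snd x ^ j) * tent_diff n (x - (2, 0)))"
  proof (rule integrable_lborel_compact_support[OF cont' compact_support_tent_diff[of "Suc n"]])
    fix x :: "real \<times> real"
    assume "x \<notin> {-1..2 * real (Suc n) + 1} \<times> {-1..1}"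
    then have "x - (2, 0) \<notin> {-1..2 * real n + 1} \<times> {-1..1}"
      by (cases x) auto
    then show "(fst x ^ i * snd x ^ j) * tent_diff n (x - (2, 0)) = 0"
      by (simp add: tent_diff_eq_0)
  qed
  have "(LINT x|lborel. (fst x ^ i * snd x ^ j) * tent_diff n (x - (2, 0)))
      = (LINT x|lborel. (fst ((2, 0) + x) ^ i * snd ((2, 0) + x) ^ j) * tent_diff n ((2, 0) + x - (2, 0)))"
    by (rule integral_lborel_translate[OF cont', symmetric])
  also have "\<dots> = (LINT x|lborel. (\<Sum>k\<le>i. (of_nat (i choose k) * 2 ^ (i - k)) *
      ((fst x ^ k * snd x ^ j) * tent_diff n x)))"
    by (intro Bochner_Integration.integral_cong refl)
      (simp add: add.commute[of 2] binomial_ring sum_distrib_right sum_distrib_left algebra_simps)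
  also have "\<dots> = (\<Sum>k\<le>i. (of_nat (i choose k) * 2 ^ (i - k)) * ?m k)"
    by (subst Bochner_Integration.integral_sum)
      (auto intro!: integrable_mult_right integrable_mult_tent_diff cont)
  \<comment> \<open>For \<open>k < i\<close> one has \<open>k < n\<close>, so the induction
    hypothesis applies. The term \<open>k = i\<close> has to stay, since \<open>i = n\<close> is
    allowed.\<close>
  also have "\<dots> = (\<Sum>k\<in>{i}. (of_nat (i choose k) * 2 ^ (i - k)) * ?m k)"
    using Suc by (intro sum.mono_neutral_right) auto
  finally have "(LINT x|lborel. (fst x ^ i * snd x ^ j) * tent_diff n (x - (2, 0))) = ?m i"
    by simp
  then show ?case
    by (simp add: right_diff_distrib Bochner_Integration.integral_diff[OF integrable_mult_tent_diff[OF cont] int])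
qed simp

section \<open>Compactly supported functions as tempered distributions\<close>

lemma smooth_imp_continuous_on: "smooth \<psi> \<Longrightarrow> continuous_on S \<psi>"
  unfolding smooth_def
  by (metis continuous_at_imp_continuous_on differentiable_imp_continuous_within empty_iff
      empty_set partials.simps(1) subsetI)

lemma schwartz_norm_0: "schwartz_norm 0 \<psi> = (SUP x. norm (\<psi> x))"
proof -
  have "{vs. set vs \<subseteq> (Basis::'a set) \<and> length vs \<le> 0} = {[]}"
    by auto
  then show ?thesis
    by (simp add: schwartz_norm_def)
qed

text \<open>A real supremum bounds its family only if the family is bounded above. Here this is the
  Schwartz condition with power 0 and no derivatives.\<close>

lemma norm_le_schwartz_norm_0:
  assumes "schwartz \<psi>"
  shows "norm (\<psi> x) \<le> schwartz_norm 0 \<psi>"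
proof -
  have "bounded (range (\<lambda>x. norm x ^ 0 *\<^sub>R partials [] \<psi> x))"
    using assms unfolding schwartz_def by (metis empty_set empty_subsetI)
  then have "bdd_above (range (\<lambda>x. norm (\<psi> x)))"
    by (auto simp: bounded_iff bdd_above_def)
  then show ?thesis
    unfolding schwartz_norm_0 by (intro cSUP_upper) auto
qed

text \<open>Integration against \<open>F\<close> is bounded by the integral of
  \<open>norm (F x)\<close> times the supremum of the test function, so the seminorm of index 0
  already gives continuity.\<close>

lemma L1_loc_tempered_compact_support:
  fixes F :: "'a::euclidean_space \<Rightarrow> complex"
  assumes F: "continuous_on UNIV F" "compact S" "\<And>x. x \<notin> S \<Longrightarrow> F x = 0"
  shows "L1_loc_tempered F"
proof -
  have intF: "integrable lebesgue F"
    using integrable_lborel_compact_support[OF F] by (simp add: integrable_completion)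
  have int: "integrable lebesgue (\<lambda>x. F x * \<psi> x)" if "schwartz \<psi>" for \<psi>
  proof -
    have "continuous_on UNIV \<psi>"
      using that smooth_imp_continuous_on unfolding schwartz_def by blast
    then have "integrable lborel (\<lambda>x. F x * \<psi> x)"
      by (intro integrable_lborel_compact_support[OF _ F(2)] continuous_intros F(1)) (simp_all add: F(3))
    then show ?thesis
      by (simp add: integrable_completion)
  qed
  define T where "T \<psi> = (LINT x|lebesgue. F x * \<psi> x)" for \<psi>
  have "norm (T \<psi>) \<le> (LINT x|lebesgue. norm (F x)) * schwartz_norm 0 \<psi>" if "schwartz \<psi>" for \<psi>
  proof -
    have "norm (T \<psi>) \<le> (LINT x|lebesgue. norm (F x * \<psi> x))"
      unfolding T_def by (rule integral_norm_bound)
    also have "\<dots> \<le> (LINT x|lebesgue. norm (F x) * schwartz_norm 0 \<psi>)"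
      using intF int[OF that]
      by (intro integral_mono integrable_norm integrable_mult_left)
        (auto simp: norm_mult intro!: mult_left_mono norm_le_schwartz_norm_0 that)
    finally show ?thesis
      by simp
  qed
  moreover have "T (\<lambda>x. \<psi> x + \<eta> x) = T \<psi> + T \<eta>" if "schwartz \<psi>" "schwartz \<eta>" for \<psi> \<eta>
    using int[OF that(1)] int[OF that(2)] by (simp add: T_def distrib_left)
  moreover have "T (\<lambda>x. c * \<psi> x) = c * T \<psi>" for c \<psi>
    unfolding T_def by (simp add: mult.left_commute[of _ c])
  ultimately have "tempered_distribution T"
    unfolding tempered_distribution_def by blast
  moreover have "L1_loc F"
    unfolding L1_loc_def set_integrable_def
    by (auto intro!: integrable_mult_indicator intF borel_compact)
  ultimately show ?thesis
    unfolding L1_loc_tempered_def using T_def by blast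
qed

section \<open>Centred boxes and single atoms in the Hardy space\<close>

lemma par_box_0: "par_box 0 \<rho> = cbox (-\<rho>, -\<rho>\<^sup>2) (\<rho>, \<rho>\<^sup>2)"
  by (simp add: par_box_def cbox_Pair_eq)

lemma measure_par_box_0_pos: "0 < \<rho> \<Longrightarrow> 0 < measure lebesgue (par_box 0 \<rho>)"
  unfolding par_box_0 by (simp add: content_Pair)

text \<open>The atom represents itself, with coefficient 1 at index 0 and 0 afterwards. The partial
  sums equal \<open>a\<close> from \<open>m = 1\<close> on; the empty sum at \<open>m = 0\<close>
  does not affect the limit.\<close>

lemma par_atom_mem_H_par:
  assumes "par_atom p N a" "L1_loc_tempered a"
  shows "a \<in> H_par p N"
proof -
  let ?c = "\<lambda>n::nat. if n = 0 then 1 else 0 :: complex"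
  have sum: "(\<Sum>n<m. ?c n * a x) = a x" if "0 < m" for m x
  proof -
    have "(\<Sum>n<m. ?c n * a x) = (\<Sum>n\<in>{0}. ?c n * a x)"
      using that by (intro sum.mono_neutral_right) auto
    then show ?thesis
      by simp
  qed
  have "summable (\<lambda>n. norm (?c n) powr p)"
    by (rule summable_finite[of "{0}"]) auto
  moreover have "(\<lambda>m. LINT x:K|lebesgue. norm (a x - (\<Sum>n<m. ?c n * a x))) \<longlonglongrightarrow> 0" for K
  proof (rule tendsto_eventually)
    show "\<forall>\<^sub>F m in sequentially. (LINT x:K|lebesgue. norm (a x - (\<Sum>n<m. ?c n * a x))) = 0"
      using eventually_gt_at_top[of 0]
      by eventually_elim (simp only: sum diff_self norm_zero, simp add: set_lebesgue_integral_def)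
  qed
  ultimately have "atomic_rep p N a ?c (\<lambda>_. a)"
    using assms unfolding atomic_rep_def L1_loc_tempered_def by blast
  then show ?thesis
    using assms(2) unfolding H_par_def by blast
qed

section \<open>Continuity of the averages and open superlevel sets\<close>

lemma continuous_on_A_par:
  assumes \<phi>: "continuous_on UNIV \<phi>" "\<And>t. 0 \<le> \<phi> t" "\<And>t. \<phi> t \<le> 1"
    "\<And>t. t \<notin> {1/2<..<5/2} \<Longrightarrow> \<phi> t = 0"
    and F: "continuous_on UNIV F" "\<And>x. norm (F x) \<le> B"
    and "0 < r"
  shows "continuous_on UNIV (A_par \<phi> r F)"
proof -
  have meas: "(\<lambda>t. (\<phi> (t / r) / r) *\<^sub>R F (fst x - t, snd x - t\<^sup>2)) \<in> borel_measurable lborel" for x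
  proof -
    have "continuous_on UNIV (\<lambda>t. (\<phi> (t / r) / r) *\<^sub>R F (fst x - t, snd x - t\<^sup>2))"
      using \<open>0 < r\<close>
      by (intro continuous_intros continuous_on_compose2[OF \<phi>(1)] continuous_on_compose2[OF F(1)]) auto
    then show ?thesis
      by (simp add: borel_measurable_continuous_onI)
  qed
  have "0 \<le> B"
    using F(2) norm_ge_zero order_trans by blast
  have A: "A_par \<phi> r F = (\<lambda>x. LINT t|lborel. (\<phi> (t / r) / r) *\<^sub>R F (fst x - t, snd x - t\<^sup>2))"
    unfolding A_par_def by (intro ext integral_completion meas)
  have "(\<lambda>n. A_par \<phi> r F (X n)) \<longlonglongrightarrow> A_par \<phi> r F x" if X: "X \<longlonglongrightarrow> x" for X x
    unfolding A
  \<comment> \<open>The factor \<open>\<phi> (t / r)\<close> vanishes unless \<open>t\<close> lies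
    between \<open>r / 2\<close> and \<open>5 * r / 2\<close>, so the majorant is independent of the
    point at which the average is taken.\<close>
  proof (rule integral_dominated_convergence[where w = "\<lambda>t. indicator {0..5 * r / 2} t * (B / r)"])
    show "integrable lborel (\<lambda>t. indicator {0..5 * r / 2} t * (B / r))"
      using \<open>0 < r\<close> by (intro integrable_mult_left integrable_real_indicator) auto
    show "AE t in lborel. (\<lambda>n. (\<phi> (t / r) / r) *\<^sub>R F (fst (X n) - t, snd (X n) - t\<^sup>2))
        \<longlonglongrightarrow> (\<phi> (t / r) / r) *\<^sub>R F (fst x - t, snd x - t\<^sup>2)"
    proof (intro AE_I2 tendsto_scaleR tendsto_const)
      fix t
      have "isCont F (fst x - t, snd x - t\<^sup>2)"
        using F(1) by (simp add: continuous_on_eq_continuous_at)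
      moreover have "(\<lambda>n. (fst (X n) - t, snd (X n) - t\<^sup>2)) \<longlonglongrightarrow> (fst x - t, snd x - t\<^sup>2)"
        by (intro tendsto_intros X)
      ultimately show "(\<lambda>n. F (fst (X n) - t, snd (X n) - t\<^sup>2)) \<longlonglongrightarrow> F (fst x - t, snd x - t\<^sup>2)"
        by (rule isCont_tendsto_compose)
    qed
    show "AE t in lborel. norm ((\<phi> (t / r) / r) *\<^sub>R F (fst (X n) - t, snd (X n) - t\<^sup>2))
        \<le> indicator {0..5 * r / 2} t * (B / r)" for n
    proof (rule AE_I2)
      fix t
      show "norm ((\<phi> (t / r) / r) *\<^sub>R F (fst (X n) - t, snd (X n) - t\<^sup>2))
          \<le> indicator {0..5 * r / 2} t * (B / r)"
      proof (cases "t \<in> {0..5 * r / 2}")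
        case True
        have "\<phi> (t / r) * norm (F (fst (X n) - t, snd (X n) - t\<^sup>2)) \<le> 1 * B"
          by (intro mult_mono \<phi> F) auto
        then show ?thesis
          using True \<open>0 < r\<close> \<phi>(2) by (simp add: divide_right_mono)
      next
        case False
        then have "t / r \<notin> {1/2<..<5/2}"
          using \<open>0 < r\<close> by (auto simp: field_simps)
        then show ?thesis
          using False \<phi>(4) by simp
      qed
    qed
  qed (use meas in auto)
  then show ?thesis
    by (simp add: continuous_on_sequentially comp_def)
qed

text \<open>Openness supplies measurability, which matters because \<^const>\<open>emeasure\<close> is \<open>0\<close> on non-measurable sets.\<close>

lemma open_M_par_superlevel:
  assumes "\<And>r. 0 < r \<Longrightarrow> continuous_on UNIV (A_par \<phi> r F)"
  shows "open {x. M_par \<phi> F x > \<alpha>}"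
proof -
  have "{x. M_par \<phi> F x > \<alpha>} = (\<Union>r\<in>{0<..}. {x. \<alpha> < ennreal (norm (A_par \<phi> r F x))})"
    by (auto simp: M_par_def less_SUP_iff)
  moreover have "open {x. \<alpha> < ennreal (norm (A_par \<phi> r F x))}" if "0 < r" for r
    by (intro open_Collect_less continuous_intros assms that continuous_on_ennreal)
  ultimately show ?thesis
    by auto
qed

section \<open>Lower bound for the averages near the parabola\<close>

lemma A_par_tent_diff_ge:
  assumes \<phi>: "continuous_on UNIV \<phi>" "\<And>t. 0 \<le> \<phi> t"
    "\<And>t. t \<in> {1<..<2} \<Longrightarrow> \<phi> t = 1" "\<And>t. t \<notin> {1/2<..<5/2} \<Longrightarrow> \<phi> t = 0"
    and \<delta>: "0 \<le> \<delta>" and s: "2 \<le> s" "s \<le> u" "u \<le> s + 1 / 4"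
  shows "3 * \<delta> / (32 * s\<^sup>2)
    \<le> norm (A_par \<phi> (2 * s / 3) (\<lambda>x. complex_of_real (\<delta> * tent_diff n x)) (u, s\<^sup>2))"
proof -
  \<comment> \<open>At this scale \<open>t = s\<close> corresponds to \<open>t / r = 3 / 2\<close>,
    the middle of the interval where \<open>\<phi>\<close> equals 1.\<close>
  define r where "r = 2 * s / 3"
  have "0 < r"
    using s by (simp add: r_def)
  define G where "G t = \<phi> (t / r) / r * (\<delta> * tent_diff n (u - t, s\<^sup>2 - t\<^sup>2))" for t
  \<comment> \<open>Since \<open>s + t\<close> is at most \<open>2 * s\<close>, this length keeps
    \<open>s\<^sup>2 - t\<^sup>2\<close> below 1/2, so the vertical tent is at least 1/2 on
    \<open>J\<close>.\<close>
  define J where "J = {s - 1 / (4 * s)..s}"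
  have J_bounds: "0 < t" "s - t \<le> 1 / 8" "t \<le> s" "\<bar>s\<^sup>2 - t\<^sup>2\<bar> \<le> 1 / 2" if "t \<in> J" for t
  proof -
    have "1 / (4 * s) \<le> 1 / 8"
      using s by (simp add: field_simps)
    then have t: "0 < t" "0 \<le> s - t" "s - t \<le> 1 / (4 * s)" "s - t \<le> 1 / 8" "t \<le> s"
      using that s unfolding J_def atLeastAtMost_iff by linarith+
    then show "0 < t" "s - t \<le> 1 / 8" "t \<le> s"
      by auto
    have "(s - t) * (s + t) \<le> 1 / (4 * s) * (2 * s)"
      using s t by (intro mult_mono) auto
    moreover have "0 \<le> (s - t) * (s + t)"
      using t s by (intro mult_nonneg_nonneg) auto
    moreover have "s\<^sup>2 - t\<^sup>2 = (s - t) * (s + t)"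
      by algebra
    ultimately show "\<bar>s\<^sup>2 - t\<^sup>2\<bar> \<le> 1 / 2"
      using s by auto
  qed
  have contG: "continuous_on UNIV G"
    unfolding G_def using \<open>0 < r\<close>
    by (intro continuous_intros continuous_on_compose2[OF \<phi>(1)]
        continuous_on_compose2[OF continuous_on_tent_diff]) auto
  \<comment> \<open>The bound holds for every \<open>t\<close>, so it also says that no negative
    part of the atom is met.\<close>
  have G_ge: "indicator J t * (\<delta> / (4 * r)) \<le> G t" for t
  \<comment> \<open>Outside this case \<open>G\<close> vanishes. The condition \<open>0 < t\<close>,
    supplied by the support of \<open>\<phi>\<close>, excludes the other branch of the parabola,
    near \<open>t = -s\<close>.\<close>
  proof (cases "0 < t \<and> \<bar>s\<^sup>2 - t\<^sup>2\<bar> < 1")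
    case False
    then have "t \<notin> J"
      using J_bounds[of t] by force
    moreover have "G t = 0"
    proof (cases "0 < t")
      case True
      then have "tent_diff n (u - t, s\<^sup>2 - t\<^sup>2) = 0"
        using False by (intro tent_diff_eq_0_snd) auto
      then show ?thesis
        by (simp add: G_def)
    next
      case False
      then have "t / r \<notin> {1/2<..<5/2}"
        using \<open>0 < r\<close> by (auto simp: field_simps)
      then show ?thesis
        using \<phi>(4) by (simp add: G_def)
    qed
    ultimately show ?thesis
      by simp
  next
    case True
    \<comment> \<open>This gives \<open>u - t \<le> 3 / 4\<close>, so the parabola meets only the
      leftmost tent, where there is no cancellation.\<close>
    have "s - 1 / 2 \<le> t"
    proof (rule power2_le_imp_le)
      have "(s - 1 / 2)\<^sup>2 = s\<^sup>2 - s + 1 / 4"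
        by (simp add: power2_eq_square algebra_simps)
      then show "(s - 1 / 2)\<^sup>2 \<le> t\<^sup>2"
        using True s by linarith
    qed (use True in simp)
    then have td: "tent_diff n (u - t, s\<^sup>2 - t\<^sup>2) = tent (u - t) * tent (s\<^sup>2 - t\<^sup>2)"
      using s by (subst tent_diff_left) auto
    show ?thesis
    proof (cases "t \<in> J")
      case False
      then show ?thesis
        using \<delta> \<phi>(2) \<open>0 < r\<close> by (simp add: G_def td tent_nonneg)
    next
      case J: True
      note t = J_bounds[OF J]
      have "\<bar>u - t\<bar> \<le> 1 / 2"
        using t s by auto
      then have "1 / 2 * (1 / 2) \<le> tent (u - t) * tent (s\<^sup>2 - t\<^sup>2)"
        using t by (intro mult_mono tent_ge_half) (auto simp: tent_nonneg)
      moreover have "\<phi> (t / r) = 1"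
        using t s by (intro \<phi>(3)) (auto simp: r_def field_simps)
      ultimately show ?thesis
        using J \<delta> \<open>0 < r\<close> mult_left_mono[of "1/4" "tent (u - t) * tent (s\<^sup>2 - t\<^sup>2)" "\<delta> / r"]
        by (simp add: G_def td)
    qed
  qed
  have "integrable lborel G"
  proof (rule integrable_lborel_compact_support[OF contG])
    show "compact {0..5 * r / 2}"
      by simp
    fix t assume "t \<notin> {0..5 * r / 2}"
    then have "t / r \<notin> {1/2<..<5/2}"
      using \<open>0 < r\<close> by (auto simp: field_simps)
    then show "G t = 0"
      using \<phi>(4) by (simp add: G_def)
  qed
  \<comment> \<open>The interval has length \<open>1 / (4 * s)\<close>; the factor 1/4 beside
    \<open>\<delta> / r\<close> is the product of the two tent bounds.\<close>
  have "3 * \<delta> / (32 * s\<^sup>2) = measure lborel J * (\<delta> / (4 * r))"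
    using s by (simp add: J_def r_def field_simps power2_eq_square)
  also have "\<dots> = (LINT t|lborel. indicator J t * (\<delta> / (4 * r)))"
    by (simp add: J_def)
  also have "\<dots> \<le> (LINT t|lborel. G t)"
    using \<open>integrable lborel G\<close> G_ge
    by (intro integral_mono integrable_mult_left integrable_real_indicator)
      (auto simp: J_def emeasure_lborel_Icc_eq)
  also have "\<dots> \<le> \<bar>LINT t|lborel. G t\<bar>"
    by simp
  also have "\<dots> = norm (A_par \<phi> r (\<lambda>x. complex_of_real (\<delta> * tent_diff n x)) (u, s\<^sup>2))"
  proof -
    have "A_par \<phi> r (\<lambda>x. complex_of_real (\<delta> * tent_diff n x)) (u, s\<^sup>2)
        = (LINT t|lebesgue. complex_of_real (G t))"
      by (simp add: A_par_def G_def scaleR_conv_of_real)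
    also have "\<dots> = complex_of_real (LINT t|lborel. G t)"
      using contG by (simp add: integral_completion borel_measurable_continuous_onI)
    finally show ?thesis
      by simp
  qed
  finally show ?thesis
    unfolding r_def .
qed

section \<open>The region where the maximal function is large\<close>

text \<open>With \<open>s = sqrt (snd x)\<close> and \<open>u = fst x\<close>, these are the points
  at which the lower bound for the averages applies, restricted to a dyadic range of
  heights.\<close>

definition parabolic_strip :: "real \<Rightarrow> (real \<times> real) set" where
  "parabolic_strip T = {x. snd x \<in> {T..2 * T} \<and> fst x \<in> {sqrt (snd x)..sqrt (snd x) + 1 / 4}}"

lemma closed_parabolic_strip: "closed (parabolic_strip T)"
  unfolding parabolic_strip_def atLeastAtMost_iff
  by (intro closed_Collect_conj closed_Collect_le continuous_intros)

text \<open>Every nonempty horizontal slice is an interval of length 1/4, and the heights fill an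
  interval of length \<open>T\<close>.\<close>

lemma emeasure_parabolic_strip:
  assumes "0 \<le> T"
  shows "emeasure lborel (parabolic_strip T) = ennreal (T / 4)"
proof -
  have "emeasure lborel (parabolic_strip T)
      = emeasure (lborel \<Otimes>\<^sub>M lborel) (parabolic_strip T)"
    by (simp add: lborel_prod)
  also have "\<dots> = (\<integral>\<^sup>+y. emeasure lborel ((\<lambda>x. (x, y)) -` parabolic_strip T) \<partial>lborel)"
    by (rule lborel_pair.emeasure_pair_measure_alt2)
      (simp only: lborel_prod sets_lborel closed_parabolic_strip borel_closed)
  also have "\<dots> = (\<integral>\<^sup>+y. ennreal (1 / 4) * indicator {T..2 * T} y \<partial>lborel)"
  proof (intro nn_integral_cong)
    fix y :: real
    have "(\<lambda>x. (x, y)) -` parabolic_strip T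
        = (if y \<in> {T..2 * T} then {sqrt y..sqrt y + 1 / 4} else {})"
      by (auto simp: parabolic_strip_def)
    then show "emeasure lborel ((\<lambda>x. (x, y)) -` parabolic_strip T)
        = ennreal (1 / 4) * indicator {T..2 * T} y"
      by simp
  qed
  also have "\<dots> = ennreal (1 / 4) * ennreal T"
    using assms by (simp add: nn_integral_cmult_indicator)
  also have "\<dots> = ennreal (T / 4)"
    using assms by (simp flip: ennreal_mult)
  finally show ?thesis .
qed

section \<open>Failure of the weak-type bound\<close>

lemma le_ennreal_powr:
  assumes "ennreal m \<le> y" "0 \<le> m" "0 \<le> s"
  shows "ennreal (m powr s) \<le> ennreal_powr y s"
proof (cases y)
  case (real b)
  then show ?thesis
    using assms by (auto simp: ennreal_powr_def intro!: ennreal_leI powr_mono2)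
qed (simp add: ennreal_powr_def)

theorem theorem1p6:
  fixes \<phi> :: "real \<Rightarrow> real" and p :: real and N :: nat
  assumes "smooth \<phi>"
    and "\<And>t. 0 \<le> \<phi> t" and "\<And>t. \<phi> t \<le> 1"
    and "\<And>t. t \<in> {1<..<2} \<Longrightarrow> \<phi> t = 1"
    and "closure {t. \<phi> t \<noteq> 0} \<subseteq> {1/2<..<5/2}"
    and "0 < p" and "p < 1"
    and "0 < N" and "\<lfloor>3 * (1 / p - 1)\<rfloor> \<le> int N"
  shows "\<not> (\<exists>C::real. \<forall>f \<in> H_par p N.
            weak_Lp_norm p (M_par \<phi> f) \<le> ennreal (C * H_par_norm p N f))"
proof
  assume "\<exists>C::real. \<forall>f \<in> H_par p N.
            weak_Lp_norm p (M_par \<phi> f) \<le> ennreal (C * H_par_norm p N f)"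
  then obtain C where C: "\<And>f. f \<in> H_par p N \<Longrightarrow>
      weak_Lp_norm p (M_par \<phi> f) \<le> ennreal (C * H_par_norm p N f)"
    by blast
  have cont_\<phi>: "continuous_on UNIV \<phi>"
    using assms(1) by (rule smooth_imp_continuous_on)
  have supp_\<phi>: "\<phi> t = 0" if "t \<notin> {1/2<..<5/2}" for t
    using that assms(5) closure_subset[of "{t. \<phi> t \<noteq> 0}"] by blast
  \<comment> \<open>The moments vanish for exponents strictly below \<open>n\<close>, and exponents
    up to \<open>N\<close> are required.\<close>
  define n where "n = Suc N"
  \<comment> \<open>This is the right end of the support of \<open>tent_diff n\<close>. As it is at
    least 1, so is its square, and the centred box contains the support.\<close>
  define \<rho> where "\<rho> = 2 * real n + 1"
  \<comment> \<open>The division by \<open>2 ^ n\<close> compensates for the sup bound of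
    \<open>tent_diff n\<close>, which gives the atom normalization.\<close>
  define \<delta> where "\<delta> = measure lebesgue (par_box 0 \<rho>) powr (- 1 / p) / 2 ^ n"
  define f where "f x = complex_of_real (\<delta> * tent_diff n x)" for x
  have "1 \<le> \<rho>"
    by (simp add: \<rho>_def)
  then have "0 < \<delta>"
    using measure_par_box_0_pos[of \<rho>] by (simp add: \<delta>_def)
  have cont_f: "continuous_on UNIV f"
    unfolding f_def by (intro continuous_intros continuous_on_tent_diff)
  have norm_f: "norm (f x) \<le> measure lebesgue (par_box 0 \<rho>) powr (- 1 / p)" for x
  proof -
    have "norm (f x) = \<delta> * \<bar>tent_diff n x\<bar>"
      using \<open>0 < \<delta>\<close> by (simp add: f_def norm_mult)
    also have "\<dots> \<le> \<delta> * 2 ^ n"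
      using \<open>0 < \<delta>\<close> by (intro mult_left_mono abs_tent_diff_le) auto
    finally show ?thesis
      by (simp add: \<delta>_def)
  qed
  have supp_f: "f x = 0" if "x \<notin> par_box 0 \<rho>" for x
  proof -
    have "1 \<le> \<rho>\<^sup>2"
      using \<open>1 \<le> \<rho>\<close> by simp
    then have "{-1..\<rho>} \<times> {-1..1} \<subseteq> par_box 0 \<rho>"
      using \<open>1 \<le> \<rho>\<close> unfolding par_box_0 cbox_Pair_eq box_real
      by (intro Sigma_mono) (subst atLeastatMost_subset_iff, linarith)+
    then have "x \<notin> {-1..2 * real n + 1} \<times> {-1..1}"
      using that unfolding \<rho>_def by blast
    then show ?thesis
      by (simp add: f_def tent_diff_eq_0)
  qed
  have "L1_loc_tempered f"
    by (rule L1_loc_tempered_compact_support[OF cont_f _ supp_f]) (auto simp: par_box_0)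
  moreover have "par_atom p N f"
    unfolding par_atom_def
  proof (intro conjI allI impI exI[of _ "0 :: real \<times> real"] exI[of _ \<rho>])
    show "f \<in> borel_measurable lebesgue"
      using cont_f by (intro measurable_completion) (simp add: borel_measurable_continuous_onI)
    show "bounded (range f)"
      using norm_f by (auto simp: bounded_iff)
    show "0 < \<rho>"
      using \<open>1 \<le> \<rho>\<close> by simp
    show "closure {x. f x \<noteq> 0} \<subseteq> par_box 0 \<rho>"
      using supp_f by (intro closure_minimal) (auto simp: par_box_0)
    show "AE x in lebesgue. norm (f x) \<le> measure lebesgue (par_box 0 \<rho>) powr (- 1 / p)"
      using norm_f by simp
    fix i j :: nat
    assume "i + j \<le> N"
    have "(LINT x|lebesgue. (fst x ^ i * snd x ^ j) *\<^sub>R f x)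
        = (LINT x|lborel. (fst x ^ i * snd x ^ j) *\<^sub>R f x)"
      by (intro integral_completion)
        (auto intro!: borel_measurable_continuous_onI continuous_intros cont_f)
    also have "\<dots> = (LINT x|lborel. complex_of_real (\<delta> * ((fst x ^ i * snd x ^ j) * tent_diff n x)))"
      by (intro Bochner_Integration.integral_cong refl)
        (simp add: f_def scaleR_conv_of_real mult_ac)
    also have "\<dots> = complex_of_real (\<delta> * (LINT x|lborel. (fst x ^ i * snd x ^ j) * tent_diff n x))"
      by (simp only: integral_complex_of_real integral_mult_right_zero)
    also have "\<dots> = 0"
      using \<open>i + j \<le> N\<close> by (simp add: tent_diff_moments n_def del: tent_diff.simps)
    finally show "(LINT x|lebesgue. (fst x ^ i * snd x ^ j) *\<^sub>R f x) = 0" .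
  qed
  ultimately have "f \<in> H_par p N"
    by (rule par_atom_mem_H_par[rotated])
  \<comment> \<open>The right side does not depend on \<open>T\<close>. The maximum with 0 is taken
    because \<open>C\<close> may be negative and \<open>ennreal\<close> truncates negative numbers.
    From \<open>4 \<le> T\<close> comes the condition \<open>2 \<le> s\<close> of the lower
    bound.\<close>
  have growth: "\<delta> / (32 * T) * (T / 4) powr (1 / p) \<le> max 0 (C * H_par_norm p N f)"
    if "4 \<le> T" for T
  proof -
    \<comment> \<open>On the strip the averages reach \<open>3 * \<delta> / (64 * T)\<close>, as
      \<open>s\<^sup>2\<close> is at most \<open>2 * T\<close>. The level \<open>\<alpha>\<close> is
      two thirds of that, which gives a strict inequality.\<close>
    define \<alpha> where "\<alpha> = \<delta> / (32 * T)"
    have "0 < \<alpha>"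
      using \<open>0 < \<delta>\<close> that by (simp add: \<alpha>_def)
    let ?L = "{x. M_par \<phi> f x > ennreal \<alpha>}"
    have "open ?L"
      by (intro open_M_par_superlevel
          continuous_on_A_par[OF cont_\<phi> assms(2,3) supp_\<phi> cont_f norm_f])
    have "parabolic_strip T \<subseteq> ?L"
    proof
      fix x
      assume x: "x \<in> parabolic_strip T"
      define s where "s = sqrt (snd x)"
      have sx: "s\<^sup>2 = snd x" "T \<le> s\<^sup>2" "s\<^sup>2 \<le> 2 * T" "s \<le> fst x" "fst x \<le> s + 1 / 4"
        using x that by (auto simp: parabolic_strip_def s_def)
      have "2 \<le> s"
        using sx(1) x that by (auto simp: parabolic_strip_def s_def intro: real_le_rsqrt)
      have "\<alpha> < 3 * \<delta> / (32 * (2 * T))"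
        using \<open>0 < \<delta>\<close> that by (simp add: \<alpha>_def field_simps)
      also have "\<dots> \<le> 3 * \<delta> / (32 * s\<^sup>2)"
        using sx \<open>0 < \<delta>\<close> that by (intro divide_left_mono) auto
      also have "\<dots> \<le> norm (A_par \<phi> (2 * s / 3) f (fst x, s\<^sup>2))"
        unfolding f_def using assms(2,4) \<open>0 < \<delta>\<close> sx \<open>2 \<le> s\<close>
        by (intro A_par_tent_diff_ge cont_\<phi> supp_\<phi>) auto
      finally have "ennreal \<alpha> < ennreal (norm (A_par \<phi> (2 * s / 3) f x))"
        using \<open>0 < \<alpha>\<close> sx(1) by (simp add: ennreal_less_iff)
      also have "\<dots> \<le> M_par \<phi> f x"
        unfolding M_par_def using \<open>2 \<le> s\<close> by (intro SUP_upper) auto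
      finally show "x \<in> ?L"
        by simp
    qed
    have "ennreal (T / 4) = emeasure lborel (parabolic_strip T)"
      using that by (simp add: emeasure_parabolic_strip)
    also have "\<dots> \<le> emeasure lborel ?L"
      using \<open>parabolic_strip T \<subseteq> ?L\<close> \<open>open ?L\<close> by (intro emeasure_mono) auto
    also have "\<dots> = emeasure lebesgue ?L"
      using \<open>open ?L\<close> by simp
    finally have "ennreal ((T / 4) powr (1 / p)) \<le> ennreal_powr (emeasure lebesgue ?L) (1 / p)"
      using that \<open>0 < p\<close> by (intro le_ennreal_powr) auto
    then have "ennreal (\<alpha> * (T / 4) powr (1 / p))
        \<le> ennreal \<alpha> * ennreal_powr (emeasure lebesgue ?L) (1 / p)"
      using \<open>0 < \<alpha>\<close> by (simp add: ennreal_mult mult_left_mono)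
    also have "\<dots> \<le> weak_Lp_norm p (M_par \<phi> f)"
      unfolding weak_Lp_norm_def using \<open>0 < \<alpha>\<close> by (intro SUP_upper) auto
    also have "\<dots> \<le> ennreal (C * H_par_norm p N f)"
      by (rule C) fact
    also have "\<dots> \<le> ennreal (max 0 (C * H_par_norm p N f))"
      by (intro ennreal_leI) simp
    finally show ?thesis
      by (subst (asm) ennreal_le_iff) (simp_all add: \<alpha>_def)
  qed
  define e where "e = 1 / p - 1"
  have "0 < e"
    using assms(6,7) by (simp add: e_def)
  define K where "K = max 0 (C * H_par_norm p N f)"
  \<comment> \<open>This solves \<open>\<delta> / 128 * S powr e = K + \<delta> / 128\<close>; the
    left side is the growth bound at \<open>T = 4 * S\<close>.\<close>
  define S where "S = (128 * K / \<delta> + 1) powr (1 / e)"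
  have "0 \<le> K"
    by (simp add: K_def)
  then have S: "K < \<delta> / 128 * S powr e" "1 \<le> S"
    using \<open>0 < \<delta>\<close> \<open>0 < e\<close> by (simp_all add: S_def powr_powr field_simps ge_one_powr_ge_zero)
  have "\<delta> / (32 * (4 * S)) * ((4 * S) / 4) powr (1 / p) = \<delta> / 128 * S powr e"
    using S(2) by (simp add: e_def powr_diff)
  then show False
    using growth[of "4 * S"] S by (simp add: K_def)
qed

end
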